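(* Let $\widehat E=E+\varepsilon E_0$ and $\widehat F=F+\varepsilon F_0$ be dual matrices in $\mathbb{D}^{m\times n}$ whose dual Moore-Penrose generalized inverses (DMPGIs) exist. Then $\widehat E\overset{{\rm P}\text{-}\ast}{\leq}\widehat F$ (P-star partial order) if and only if $\widehat E\overset{{\rm DM}\text{-}\ast}{\leq}\widehat F$ (Dual-minus star partial order) and $$EE^\dagger(F_0-E_0)=O,\qquad (F_0-E_0)E^\dagger E=O.$$
   Context: $\varepsilon$ is the dual unit: $\varepsilon\neq 0$, $\varepsilon^2=0$, commuting with reals. $\mathbb{D}^{m\times n}$ is the set of $m\times n$ dual matrices $\widehat E=E+\varepsilon E_0$ with $E,E_0\in\mathbb{R}^{m\times n}$, with the obvious addition, multiplication and transpose $\widehat E^{T}=E^T+\varepsilon E_0^T$. The DMPGI of $\widehat E\in\mathbb{D}^{m\times n}$ is the unique $\widehat X\in\mathbb{D}^{n\times m}$, if it exists, with $\widehat E\widehat X\widehat E=\widehat E$, $\widehat X\widehat E\widehat X=\widehat X$, $(\widehat E\widehat X)^T=\widehat E\widehat X$, $(\widehat X\widehat E)^T=\widehat X\widehat E$. For a real matrix $E$, $E^\dagger$ is the usual Moore-Penrose inverse. The Moore-Penrose dual generalized inverse of $\widehat E$ (which always exists) is $\widehat E^{p}=E^\dagger-\varepsilon E^\dagger E_0E^\dagger$. Star partial order on real $m\times n$ matrices: $E\overset{\ast}{\leq}F$ means $E^{T}E=E^{T}F$ and $EE^{T}=FE^{T}$. For $\widehat E,\widehat F\in\mathbb{D}^{m\times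 n}$ whose DMPGIs exist: (i) Dual-minus star partial order: $\widehat E\overset{{\rm DM}\text{-}\ast}{\leq}\widehat F$ means that $E\overset{\ast}{\leq}F$ and the DMPGI of $\widehat F-\widehat E$ exists. (ii) P-star partial order: $\widehat E\overset{{\rm P}\text{-}\ast}{\leq}\widehat F$ means $\widehat E^{p}\widehat E=\widehat E^{p}\widehat F$ and $\widehat E\widehat E^{p}=\widehat F\widehat E^{p}$. *)

theory Defs
  imports "HOL-Analysis.Analysis"
begin

text \<open>
  Dual numbers \<open>a + \<epsilon> b\<close> with \<open>\<epsilon>\<^sup>2 = 0\<close>, as a commutative real algebra. Dual \<open>m \<times> n\<close> matrices
  are then the elements of \<open>dual^'n^'m\<close>, with the library's matrix operations.
\<close>

datatype dual = Dual (std_part: real) (dual_part: real)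

lemma dual_eq_iff: "x = y \<longleftrightarrow> std_part x = std_part y \<and> dual_part x = dual_part y"
  by (cases x; cases y) simp

instantiation dual :: "{comm_ring_1, real_algebra_1}"
begin

definition "0 = Dual 0 0"
definition "1 = Dual 1 0"
definition "x + y = Dual (std_part x + std_part y) (dual_part x + dual_part y)"
definition "x - y = Dual (std_part x - std_part y) (dual_part x - dual_part y)"
definition "- x = Dual (- std_part x) (- dual_part x)"
definition "x * y =
  Dual (std_part x * std_part y) (std_part x * dual_part y + dual_part x * std_part y)"
definition "r *\<^sub>R x = Dual (r * std_part x) (r * dual_part x)"

instance
  by standard
    (simp_all add: zero_dual_def one_dual_def plus_dual_def minus_dual_def uminus_dual_def
      times_dual_def scaleR_dual_def algebra_simps dual_eq_iff)

end

definition dual_unit :: dual  (\<open>\<epsilon>\<close>)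
  where "\<epsilon> = Dual 0 1"

lemma dual_unit: "\<epsilon> \<noteq> 0" "\<epsilon> * \<epsilon> = 0"
  by (simp_all add: dual_unit_def zero_dual_def times_dual_def)

lemma Dual_eq: "Dual a b = of_real a + \<epsilon> * of_real b"
  by (simp add: of_real_def dual_unit_def plus_dual_def times_dual_def scaleR_dual_def one_dual_def)

text \<open>The dual matrix \<open>E + \<epsilon> E\<^sub>0\<close>, and its two real parts.\<close>

definition dual_mat :: "real^'n^'m \<Rightarrow> real^'n^'m \<Rightarrow> dual^'n^'m"
  where "dual_mat E E0 = (\<chi> i j. of_real (E $ i $ j) + \<epsilon> * of_real (E0 $ i $ j))"

definition std_mat :: "dual^'n^'m \<Rightarrow> real^'n^'m"
  where "std_mat A = map_matrix std_part A"

definition inf_mat :: "dual^'n^'m \<Rightarrow> real^'n^'m"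
  where "inf_mat A = map_matrix dual_part A"

lemma std_mat_dual_mat [simp]: "std_mat (dual_mat E E0) = E"
  by (simp add: std_mat_def dual_mat_def vec_eq_iff flip: Dual_eq)

lemma inf_mat_dual_mat [simp]: "inf_mat (dual_mat E E0) = E0"
  by (simp add: inf_mat_def dual_mat_def vec_eq_iff flip: Dual_eq)

lemma dual_mat_parts: "dual_mat (std_mat A) (inf_mat A) = A"
  by (simp add: std_mat_def inf_mat_def dual_mat_def vec_eq_iff flip: Dual_eq)

text \<open>
  The four Penrose equations, for real and for dual matrices alike. They have at most one
  solution; over the reals they always have one, over the dual numbers they may have none.
\<close>

definition is_mp_inverse :: "'a::comm_ring_1^'n^'m \<Rightarrow> 'a^'m^'n \<Rightarrow> bool"
  where "is_mp_inverse A X \<longleftrightarrow>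
    A ** X ** A = A \<and> X ** A ** X = X \<and>
    transpose (A ** X) = A ** X \<and> transpose (X ** A) = X ** A"

lemma is_mp_inverse_unique:
  assumes "is_mp_inverse A X" "is_mp_inverse A Y"
  shows "X = Y"
proof -
  have X: "A ** X ** A = A" "X ** A ** X = X" "transpose (A ** X) = A ** X"
      "transpose (X ** A) = X ** A"
    and Y: "A ** Y ** A = A" "Y ** A ** Y = Y" "transpose (A ** Y) = A ** Y"
      "transpose (Y ** A) = Y ** A"
    using assms by (auto simp: is_mp_inverse_def)
  have "A ** X = transpose ((A ** Y) ** (A ** X))"
    by (metis X(3) Y(1) matrix_mul_assoc)
  then have AX: "A ** X = A ** Y"
    by (metis X(1) X(3) Y(3) matrix_mul_assoc matrix_transpose_mul)
  have "X ** A = transpose ((X ** A) ** (Y ** A))"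
    by (metis X(4) Y(1) matrix_mul_assoc)
  then have XA: "X ** A = Y ** A"
    by (metis X(1) X(4) Y(4) matrix_mul_assoc matrix_transpose_mul)
  show ?thesis
    by (metis X(2) Y(2) AX XA matrix_mul_assoc)
qed

lemma ex_least_squares_inverse:
  fixes A :: "real^'n^'m"
  shows "\<exists>Z. A ** Z ** A = A \<and> transpose (A ** Z) = A ** Z"
proof -
  have "\<exists>x. transpose A *v (A *v x) = transpose A *v y" for y
  proof -
    obtain u z where u: "u \<in> span (range ((*v) A))"
      and z: "\<And>w. w \<in> span (range ((*v) A)) \<Longrightarrow> orthogonal z w" and y: "y = u + z"
      using orthogonal_subspace_decomp_exists[of "range ((*v) A)" y] by metis
    have "subspace (range ((*v) A))"
      by (intro linear_subspace_image) auto
    then obtain x where x: "u = A *v x"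
      using u by (auto simp: span_eq_iff[THEN iffD2])
    have "(transpose A *v z) \<bullet> w = 0" for w
      using z[of "A *v w"] span_base[of "A *v w" "range ((*v) A)"]
      by (simp add: orthogonal_def dot_lmul_matrix)
    then have "transpose A *v z = 0"
      by (metis inner_eq_zero_iff)
    then show ?thesis
      by (auto simp: y x matrix_vector_right_distrib)
  qed
  then obtain f where f: "\<And>y. transpose A *v (A *v f y) = transpose A *v y"
    by metis
  define Z where "Z = (\<chi> i j. f (axis j 1) $ i)"
  have "Z *v axis j 1 = f (axis j 1)" for j
    by (simp add: Z_def matrix_vector_mult_basis column_def vec_eq_iff)
  then have "(transpose A ** A ** Z) *v axis j 1 = transpose A *v axis j 1" for j
    using f[of "axis j 1"] by (metis matrix_vector_mul_assoc)
  then have "column j (transpose A ** A ** Z) = column j (transpose A)" for j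
    by (metis matrix_vector_mult_basis)
  then have normal: "transpose A ** A ** Z = transpose A"
    by (simp add: column_def vec_eq_iff)
  then have "transpose (A ** Z) ** (A ** Z) = transpose (A ** Z)"
    by (metis matrix_mul_assoc matrix_transpose_mul)
  then have sym: "transpose (A ** Z) = A ** Z"
    by (metis matrix_transpose_mul transpose_transpose)
  have "A = transpose (transpose A ** A ** Z)"
    by (simp add: normal)
  also have "\<dots> = A ** Z ** A"
    by (metis sym matrix_mul_assoc matrix_transpose_mul transpose_transpose)
  finally show ?thesis
    using sym by metis
qed

lemma ex_is_mp_inverse_real:
  fixes A :: "real^'n^'m"
  shows "\<exists>X. is_mp_inverse A X"
proof -
  obtain Z where Z: "A ** Z ** A = A" "transpose (A ** Z) = A ** Z"
    using ex_least_squares_inverse by blast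
  obtain V where V: "transpose A ** V ** transpose A = transpose A"
      "transpose (transpose A ** V) = transpose A ** V"
    using ex_least_squares_inverse by blast
  define W where "W = transpose V"
  have W: "A ** W ** A = A" "transpose (W ** A) = W ** A"
    using V unfolding W_def by (metis matrix_mul_assoc matrix_transpose_mul transpose_transpose)+
  have AX: "A ** (W ** A ** Z) = A ** Z" and XA: "(W ** A ** Z) ** A = W ** A"
    by (metis Z W matrix_mul_assoc)+
  have "is_mp_inverse A (W ** A ** Z)"
    unfolding is_mp_inverse_def AX XA using Z W by (metis XA matrix_mul_assoc)
  then show ?thesis ..
qed

text \<open>The Moore-Penrose inverse \<open>E\<^sup>\<dagger>\<close> of a real matrix.\<close>

definition pinv :: "real^'n^'m \<Rightarrow> real^'m^'n"
  where "pinv A = (THE X. is_mp_inverse A X)"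

lemma is_mp_inverse_pinv: "is_mp_inverse A (pinv A)"
  unfolding pinv_def
  by (rule theI') (metis ex_is_mp_inverse_real is_mp_inverse_unique)

definition DMPGI_exists :: "dual^'n^'m \<Rightarrow> bool"
  where "DMPGI_exists A \<longleftrightarrow> (\<exists>!X. is_mp_inverse A X)"

text \<open>
  The Moore-Penrose dual generalized inverse \<open>A\<^sup>p\<close>, which in general differs from the DMPGI.
\<close>

definition MPDGI :: "dual^'n^'m \<Rightarrow> dual^'m^'n"
  where "MPDGI A =
    dual_mat (pinv (std_mat A)) (- (pinv (std_mat A) ** inf_mat A ** pinv (std_mat A)))"

definition star_le :: "real^'n^'m \<Rightarrow> real^'n^'m \<Rightarrow> bool"
  where "star_le E F \<longleftrightarrow>
    transpose E ** E = transpose E ** F \<and> E ** transpose E = F ** transpose E"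

text \<open>
  The two orders are meant for dual matrices whose DMPGIs exist; this is assumed where they are
  used rather than built into the relations.
\<close>

definition DM_star_le :: "dual^'n^'m \<Rightarrow> dual^'n^'m \<Rightarrow> bool"
  where "DM_star_le A B \<longleftrightarrow> star_le (std_mat A) (std_mat B) \<and> DMPGI_exists (B - A)"

definition P_star_le :: "dual^'n^'m \<Rightarrow> dual^'n^'m \<Rightarrow> bool"
  where "P_star_le A B \<longleftrightarrow>
    MPDGI A ** A = MPDGI A ** B \<and> A ** MPDGI A = B ** MPDGI A"

end

theory Submission
  imports Defs
begin

text \<open>
  Write \<open>P = E\<^sup>\<dagger>\<close> and let \<open>G + \<epsilon> G\<^sub>0\<close> be the difference of the two dual matrices. The P-star order
  says that \<open>P\<close> annihilates \<open>G\<close> and \<open>G\<^sub>0\<close> from both sides, and \<open>P G = 0\<close>, \<open>G P = 0\<close> is the star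
  order of the standard parts. It remains to see that \<open>G + \<epsilon> G\<^sub>0\<close> then has a DMPGI. A DMPGI of
  \<open>A + \<epsilon> B\<close> exists iff \<open>(I - A A\<^sup>\<dagger>) B (I - A\<^sup>\<dagger> A) = 0\<close>. Since \<open>F\<^sup>\<dagger> = E\<^sup>\<dagger> + G\<^sup>\<dagger>\<close>, the projection
  \<open>I - F F\<^sup>\<dagger>\<close> is the product of \<open>I - E E\<^sup>\<dagger>\<close> and \<open>I - G G\<^sup>\<dagger>\<close>, and likewise on the other side, so that
  the criteria for \<open>E + \<epsilon> E\<^sub>0\<close> and \<open>F + \<epsilon> F\<^sub>0\<close> together give the one for \<open>G + \<epsilon> G\<^sub>0\<close>.
\<close>

lemma matrix_add_rdistrib:
  fixes A B :: "'a::semiring_1^'n^'m"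
  shows "(A + B) ** C = A ** C + B ** C"
  by (simp add: matrix_matrix_mult_def vec_eq_iff distrib_right sum.distrib)

lemma matrix_diff_ldistrib:
  fixes A :: "'a::ring_1^'n^'m"
  shows "A ** (B - C) = A ** B - A ** C"
  by (simp add: matrix_matrix_mult_def vec_eq_iff right_diff_distrib sum_subtractf)

lemma matrix_diff_rdistrib:
  fixes A B :: "'a::ring_1^'n^'m"
  shows "(A - B) ** C = A ** C - B ** C"
  by (simp add: matrix_matrix_mult_def vec_eq_iff left_diff_distrib sum_subtractf)

lemma matrix_minus_mult:
  fixes A :: "'a::ring_1^'n^'m"
  shows "(- A) ** B = - (A ** B)" "A ** (- B) = - (A ** B)"
  by (simp_all add: matrix_matrix_mult_def vec_eq_iff sum_negf)

lemma transpose_add: "transpose (A + B) = transpose A + transpose B"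
  by (simp add: transpose_def vec_eq_iff)

lemma transpose_diff:
  fixes A B :: "'a::ab_group_add^'n^'m"
  shows "transpose (A - B) = transpose A - transpose B"
  by (simp add: transpose_def vec_eq_iff)

lemma transpose_minus:
  fixes A :: "'a::ab_group_add^'n^'m"
  shows "transpose (- A) = - transpose A"
  by (simp add: transpose_def vec_eq_iff)

lemma transpose_zero: "transpose 0 = 0"
  by (simp add: transpose_def vec_eq_iff)

lemmas matrix_ring_simps = matrix_mul_assoc[symmetric] matrix_add_ldistrib matrix_add_rdistrib
  matrix_diff_ldistrib matrix_diff_rdistrib matrix_minus_mult
  transpose_add transpose_diff transpose_minus matrix_transpose_mul

lemma dual_mat_nth: "dual_mat A B $ i $ j = Dual (A $ i $ j) (B $ i $ j)"
  by (simp add: dual_mat_def Dual_eq)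

lemma dual_mat_eq_iff: "dual_mat A B = dual_mat C D \<longleftrightarrow> A = C \<and> B = D"
  by (metis std_mat_dual_mat inf_mat_dual_mat)

lemma dual_mat_eq_0_iff: "dual_mat A B = 0 \<longleftrightarrow> A = 0 \<and> B = 0"
  by (auto simp: vec_eq_iff dual_mat_nth zero_dual_def)

lemma sum_Dual: "(\<Sum>k\<in>S. Dual (f k) (g k)) = Dual (sum f S) (sum g S)"
  by (induction S rule: infinite_finite_induct) (simp_all add: zero_dual_def plus_dual_def)

lemma dual_mat_mult: "dual_mat A B ** dual_mat C D = dual_mat (A ** C) (A ** D + B ** C)"
  by (simp add: vec_eq_iff dual_mat_nth matrix_matrix_mult_def times_dual_def sum_Dual sum.distrib)

lemma dual_mat_diff: "dual_mat A B - dual_mat C D = dual_mat (A - C) (B - D)"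
  by (simp add: vec_eq_iff dual_mat_nth minus_dual_def)

lemma transpose_dual_mat: "transpose (dual_mat A B) = dual_mat (transpose A) (transpose B)"
  by (simp add: vec_eq_iff dual_mat_nth transpose_def)

text \<open>Every rule has a variant with a trailing factor, so that it also fires inside the
  right-nested products produced by \<open>matrix_ring_simps\<close>.\<close>

lemma is_mp_inverse_cancel:
  assumes "is_mp_inverse A X"
  shows "A ** (X ** A) = A" "A ** (X ** (A ** Y)) = A ** Y"
    "X ** (A ** X) = X" "X ** (A ** (X ** Z)) = X ** Z"
    "transpose X ** transpose A = A ** X" "transpose X ** (transpose A ** Z) = A ** (X ** Z)"
    "transpose A ** transpose X = X ** A" "transpose A ** (transpose X ** Y) = X ** (A ** Y)"
    "A ** (X ** transpose X) = transpose X" "A ** (X ** (transpose X ** V)) = transpose X ** V"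
    "X ** (A ** transpose A) = transpose A" "X ** (A ** (transpose A ** W)) = transpose A ** W"
    "transpose X ** (X ** A) = transpose X" "transpose X ** (X ** (A ** Y)) = transpose X ** Y"
    "transpose A ** (A ** X) = transpose A" "transpose A ** (A ** (X ** Z)) = transpose A ** Z"
proof -
  show eq: "A ** (X ** A) = A" "X ** (A ** X) = X"
    "transpose X ** transpose A = A ** X" "transpose A ** transpose X = X ** A"
    using assms unfolding is_mp_inverse_def matrix_transpose_mul matrix_mul_assoc by blast+
  show "A ** (X ** transpose X) = transpose X" "transpose X ** (X ** A) = transpose X"
    "X ** (A ** transpose A) = transpose A" "transpose A ** (A ** X) = transpose A"
    unfolding eq(3,4)[symmetric] matrix_mul_assoc
    unfolding matrix_transpose_mul[symmetric] using eq by (simp_all add: matrix_mul_assoc)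
  then show "A ** (X ** (A ** Y)) = A ** Y" "X ** (A ** (X ** Z)) = X ** Z"
    "transpose X ** (transpose A ** Z) = A ** (X ** Z)"
    "transpose A ** (transpose X ** Y) = X ** (A ** Y)"
    "A ** (X ** (transpose X ** V)) = transpose X ** V"
    "X ** (A ** (transpose A ** W)) = transpose A ** W"
    "transpose X ** (X ** (A ** Y)) = transpose X ** Y"
    "transpose A ** (A ** (X ** Z)) = transpose A ** Z"
    using eq by (simp_all add: matrix_mul_assoc)
qed

lemmas pinv_cancel = is_mp_inverse_cancel[OF is_mp_inverse_pinv]

lemma pinv_eqI: "is_mp_inverse A X \<Longrightarrow> pinv A = X"
  using is_mp_inverse_pinv is_mp_inverse_unique by blast

text \<open>Each of the two is a left multiple of the other:
  \<open>transpose A = (transpose A ** A) ** pinv A\<close> and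
  \<open>pinv A = (pinv A ** transpose (pinv A)) ** transpose A\<close>. This lets the star order be
  stated with \<open>pinv\<close>.\<close>

lemma pinv_mult_eq_0_iff: "pinv A ** B = 0 \<longleftrightarrow> transpose A ** B = 0"
proof
  assume "pinv A ** B = 0"
  then have "transpose A ** (transpose (pinv A) ** (transpose A ** B)) = 0"
    by (simp add: pinv_cancel)
  then show "transpose A ** B = 0"
    by (simp add: pinv_cancel)
next
  assume "transpose A ** B = 0"
  then have "pinv A ** (transpose (pinv A) ** (transpose A ** B)) = 0"
    by simp
  then show "pinv A ** B = 0"
    by (simp add: pinv_cancel)
qed

lemma mult_pinv_mult_eq_0_iff:
  "A ** pinv A ** B = 0 \<longleftrightarrow> pinv A ** B = 0"
  "C ** pinv A ** A = 0 \<longleftrightarrow> C ** pinv A = 0"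
proof -
  have "pinv A ** B = pinv A ** (A ** pinv A ** B)" "C ** pinv A = C ** pinv A ** A ** pinv A"
    by (simp_all add: matrix_mul_assoc[symmetric] pinv_cancel)
  moreover have "A ** pinv A ** B = A ** (pinv A ** B)"
    by (rule matrix_mul_assoc[symmetric])
  ultimately show "A ** pinv A ** B = 0 \<longleftrightarrow> pinv A ** B = 0"
    "C ** pinv A ** A = 0 \<longleftrightarrow> C ** pinv A = 0"
    by (metis times0_left times0_right)+
qed

lemma mult_pinv_eq_0_iff: "B ** pinv A = 0 \<longleftrightarrow> B ** transpose A = 0"
proof
  assume "B ** pinv A = 0"
  then have "(B ** pinv A) ** (A ** transpose A) = 0"
    by simp
  then show "B ** transpose A = 0"
    by (simp add: matrix_mul_assoc[symmetric] pinv_cancel)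
next
  assume "B ** transpose A = 0"
  then have "(B ** transpose A) ** (transpose (pinv A) ** pinv A) = 0"
    by simp
  then show "B ** pinv A = 0"
    by (simp add: matrix_mul_assoc[symmetric] pinv_cancel)
qed

lemma star_le_iff_pinv:
  "star_le E F \<longleftrightarrow> pinv E ** (F - E) = 0 \<and> (F - E) ** pinv E = 0"
  unfolding star_le_def pinv_mult_eq_0_iff mult_pinv_eq_0_iff
  by (auto simp: matrix_diff_ldistrib matrix_diff_rdistrib)

text \<open>The right-hand side is \<open>(I - A A\<^sup>\<dagger>) B (I - A\<^sup>\<dagger> A) = 0\<close>, multiplied out.\<close>

lemma DMPGI_exists_iff:
  "DMPGI_exists (dual_mat A B) \<longleftrightarrow>
    B + A ** pinv A ** B ** pinv A ** A = A ** pinv A ** B + B ** pinv A ** A"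
proof
  assume "DMPGI_exists (dual_mat A B)"
  then obtain X where "is_mp_inverse (dual_mat A B) X"
    by (auto simp: DMPGI_exists_def)
  then obtain Y C where YC: "is_mp_inverse (dual_mat A B) (dual_mat Y C)"
    by (metis dual_mat_parts)
  then have "is_mp_inverse A Y"
    by (simp add: is_mp_inverse_def dual_mat_mult transpose_dual_mat dual_mat_eq_iff)
  then have Y: "Y = pinv A"
    by (metis pinv_eqI)
  have B: "B = A ** pinv A ** B + (A ** C + B ** pinv A) ** A"
    using YC by (simp add: is_mp_inverse_def dual_mat_mult dual_mat_eq_iff Y)
  \<comment> \<open>Multiplying by the projection \<open>A ** pinv A\<close> determines
    \<open>A ** C ** A\<close>, the only term through which the unknown \<open>C\<close> enters the
    equation for \<open>B\<close>.\<close>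
  then have "A ** pinv A ** B = A ** pinv A ** (A ** pinv A ** B + (A ** C + B ** pinv A) ** A)"
    by simp
  then have "A ** (pinv A ** (B ** (pinv A ** A))) = - (A ** (C ** A))"
    by (simp add: matrix_ring_simps pinv_cancel eq_neg_iff_add_eq_0 add.commute)
  moreover have "B = A ** (pinv A ** B) + A ** (C ** A) + B ** (pinv A ** A)"
    using B by (simp add: matrix_ring_simps add.assoc)
  ultimately show "B + A ** pinv A ** B ** pinv A ** A = A ** pinv A ** B + B ** pinv A ** A"
    unfolding matrix_mul_assoc[symmetric] by (simp add: algebra_simps)
next
  assume "B + A ** pinv A ** B ** pinv A ** A = A ** pinv A ** B + B ** pinv A ** A"
  then have *: "A ** (pinv A ** B) + B ** (pinv A ** A) - A ** (pinv A ** (B ** (pinv A ** A))) = B"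
    unfolding matrix_mul_assoc[symmetric] by (simp add: diff_eq_eq)
  define P where "P = pinv A"
  note cancel = pinv_cancel[of A, folded P_def]
  \<comment> \<open>\<open>C = (A\<^sup>T A)\<^sup>\<dagger> B\<^sup>T (I - A P) + (I - P A) B\<^sup>T (A A\<^sup>T)\<^sup>\<dagger> - P B P\<close>,
    where \<open>(A\<^sup>T A)\<^sup>\<dagger> = P P\<^sup>T\<close> and \<open>(A A\<^sup>T)\<^sup>\<dagger> = P\<^sup>T P\<close>\<close>
  define C where "C = P ** transpose P ** transpose B - P ** transpose P ** transpose B ** A ** P
    + transpose B ** transpose P ** P - P ** A ** transpose B ** transpose P ** P - P ** B ** P"
  \<comment> \<open>With \<open>N = (I - A P) B P\<close> the right-hand side is \<open>N\<close>
    plus its transpose; in \<open>CA\<close> the same holds with \<open>P B (I - P A)\<close>. Both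
    symmetry equations follow.\<close>
  have AC: "A ** C + B ** P = transpose P ** transpose B - transpose P ** (transpose B ** (A ** P))
      + (B ** P - A ** (P ** (B ** P)))"
    unfolding C_def by (simp add: matrix_ring_simps cancel)
  have CA: "P ** B + C ** A = P ** B - P ** (B ** (P ** A))
      + (transpose B ** transpose P - P ** (A ** (transpose B ** transpose P)))"
    unfolding C_def by (simp add: matrix_ring_simps cancel)
  have "A ** (P ** B) + (A ** C + B ** P) ** A = B"
    unfolding AC using * by (simp add: matrix_ring_simps cancel P_def[symmetric] add_diff_eq)
  moreover have "P ** (A ** C) + (P ** B + C ** A) ** P = C"
    unfolding CA unfolding C_def by (simp add: matrix_ring_simps cancel)
  moreover have "transpose (A ** C + B ** P) = A ** C + B ** P"
    unfolding AC by (simp add: matrix_ring_simps cancel)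
  moreover have "transpose (P ** B + C ** A) = P ** B + C ** A"
    unfolding CA by (simp add: matrix_ring_simps cancel)
  ultimately have "is_mp_inverse (dual_mat A B) (dual_mat P C)"
    by (simp add: is_mp_inverse_def dual_mat_mult transpose_dual_mat dual_mat_eq_iff
        matrix_mul_assoc[symmetric] matrix_transpose_mul cancel)
  then show "DMPGI_exists (dual_mat A B)"
    unfolding DMPGI_exists_def using is_mp_inverse_unique by blast
qed

text \<open>Both equations say that \<open>MPDGI\<close> of the first matrix annihilates the
  difference. In the infinitesimal parts, the term with \<open>E0\<close> contains
  \<open>pinv E ** (F - E)\<close> or \<open>(F - E) ** pinv E\<close>, which vanishes by the
  standard part.\<close>

lemma P_star_le_iff:
  "P_star_le (dual_mat E E0) (dual_mat F F0) \<longleftrightarrow>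
    star_le E F \<and> pinv E ** (F0 - E0) = 0 \<and> (F0 - E0) ** pinv E = 0"
proof -
  let ?P = "pinv E" and ?D = "dual_mat (F - E) (F0 - E0)" and ?X = "MPDGI (dual_mat E E0)"
  have "?X ** ?D = 0 \<longleftrightarrow> ?P ** (F - E) = 0 \<and> ?P ** (F0 - E0) - ?P ** E0 ** (?P ** (F - E)) = 0"
    by (simp add: MPDGI_def dual_mat_mult dual_mat_eq_0_iff matrix_minus_mult matrix_mul_assoc)
  then have "?X ** ?D = 0 \<longleftrightarrow> ?P ** (F - E) = 0 \<and> ?P ** (F0 - E0) = 0"
    by auto
  moreover have "?D ** ?X = 0 \<longleftrightarrow>
      (F - E) ** ?P = 0 \<and> (F0 - E0) ** ?P - (F - E) ** ?P ** (E0 ** ?P) = 0"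
    by (simp add: MPDGI_def dual_mat_mult dual_mat_eq_0_iff matrix_minus_mult matrix_mul_assoc)
  then have "?D ** ?X = 0 \<longleftrightarrow> (F - E) ** ?P = 0 \<and> (F0 - E0) ** ?P = 0"
    by auto
  moreover have "P_star_le (dual_mat E E0) (dual_mat F F0) \<longleftrightarrow> ?X ** ?D = 0 \<and> ?D ** ?X = 0"
    unfolding P_star_le_def dual_mat_diff[symmetric]
    by (auto simp: matrix_diff_ldistrib matrix_diff_rdistrib)
  ultimately show ?thesis
    unfolding star_le_iff_pinv by auto
qed

text \<open>In terms of transposes the hypotheses are symmetric in \<open>E\<close> and
  \<open>G\<close>, so all mixed products with \<open>pinv\<close> vanish and the Penrose equations
  for the sum split.\<close>

lemma pinv_orthogonal_add:
  assumes "pinv E ** G = 0" "G ** pinv E = 0"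
  shows "pinv G ** E = 0" "E ** pinv G = 0" "pinv (E + G) = pinv E + pinv G"
proof -
  have "transpose E ** G = 0" "G ** transpose E = 0"
    using assms by (simp_all add: pinv_mult_eq_0_iff mult_pinv_eq_0_iff)
  moreover have "transpose G ** E = transpose (transpose E ** G)"
    "E ** transpose G = transpose (G ** transpose E)"
    by (simp_all add: matrix_transpose_mul)
  ultimately have "transpose G ** E = 0" "E ** transpose G = 0"
    by (simp_all add: transpose_zero)
  then show *: "pinv G ** E = 0" "E ** pinv G = 0"
    by (simp_all add: pinv_mult_eq_0_iff mult_pinv_eq_0_iff)
  have **: "pinv G ** (E ** Y) = 0" "pinv E ** (G ** Y) = 0"
    "E ** (pinv G ** Z) = 0" "G ** (pinv E ** Z) = 0"
    for Y :: "real^'x^_" and Z :: "real^'y^_"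
    by (simp_all add: matrix_mul_assoc * assms)
  have "is_mp_inverse (E + G) (pinv E + pinv G)"
    unfolding is_mp_inverse_def
    by (simp add: matrix_ring_simps pinv_cancel * ** assms)
  then show "pinv (E + G) = pinv E + pinv G"
    by (rule pinv_eqI)
qed

lemma DMPGI_exists_diff:
  assumes "DMPGI_exists (dual_mat E E0)" "DMPGI_exists (dual_mat (E + G) (E0 + G0))"
    and G: "pinv E ** G = 0" "G ** pinv E = 0" and G0: "pinv E ** G0 = 0" "G0 ** pinv E = 0"
  shows "DMPGI_exists (dual_mat G G0)"
proof -
  note o = pinv_orthogonal_add[OF G]
  have z: "pinv G ** (E ** Y) = 0" "pinv E ** (G ** Y) = 0"
    "E ** (pinv G ** Z) = 0" "G ** (pinv E ** Z) = 0"
    "pinv E ** (G0 ** Y) = 0" "G0 ** (pinv E ** Z) = 0"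
    for Y :: "real^'x^_" and Z :: "real^'y^_"
    by (simp_all add: matrix_mul_assoc o G G0)
  \<comment> \<open>\<open>R\<close> is \<open>(I - E E\<^sup>\<dagger>) E\<^sub>0 (I -
    E\<^sup>\<dagger> E)\<close>, the obstruction to a DMPGI of the first matrix.\<close>
  define R where "R = E0 + E ** pinv E ** E0 ** pinv E ** E - E ** pinv E ** E0 - E0 ** pinv E ** E"
  have R: "R = 0"
    using assms(1) by (simp add: R_def DMPGI_exists_iff)
  let ?A = "E + G" and ?B = "E0 + G0"
  let ?L = "?B + ?A ** pinv ?A ** ?B ** pinv ?A ** ?A - (?A ** pinv ?A ** ?B + ?B ** pinv ?A ** ?A)"
  \<comment> \<open>The obstruction \<open>?L\<close> of the sum is additive in \<open>E0\<close>
    and \<open>G0\<close>: the first part is \<open>R\<close> between the complementary projections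
    of \<open>G\<close>, the second is the obstruction for \<open>G\<close>, as
    \<open>pinv E\<close> annihilates \<open>G0\<close> on both sides.\<close>
  have "?L = (R - G ** pinv G ** R - R ** pinv G ** G + G ** pinv G ** R ** pinv G ** G)
    + (G0 + G ** pinv G ** G0 ** pinv G ** G - (G ** pinv G ** G0 + G0 ** pinv G ** G))"
    unfolding R_def o by (simp add: matrix_ring_simps o z G G0)
  moreover have "?L = 0"
    using assms(2) by (simp only: DMPGI_exists_iff diff_self)
  ultimately have "G0 + G ** pinv G ** G0 ** pinv G ** G - (G ** pinv G ** G0 + G0 ** pinv G ** G) = 0"
    by (simp only: R times0_left times0_right diff_self add_0_left add_0_right)
  then show ?thesis
    by (simp add: DMPGI_exists_iff)
qed

theorem theorem5p8:
  fixes E E0 F F0 :: "real^'n^'m"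
  assumes "DMPGI_exists (dual_mat E E0)" and "DMPGI_exists (dual_mat F F0)"
  shows "P_star_le (dual_mat E E0) (dual_mat F F0) \<longleftrightarrow>
    DM_star_le (dual_mat E E0) (dual_mat F F0) \<and>
    E ** pinv E ** (F0 - E0) = 0 \<and> (F0 - E0) ** pinv E ** E = 0"
proof -
  \<comment> \<open>All other conditions match \<open>P_star_le_iff\<close> once
    \<open>mult_pinv_mult_eq_0_iff\<close> removes the outer factors \<open>E\<close>.\<close>
  have "DMPGI_exists (dual_mat (F - E) (F0 - E0))"
    if "P_star_le (dual_mat E E0) (dual_mat F F0)"
  proof (rule DMPGI_exists_diff[of E E0])
    show "DMPGI_exists (dual_mat (E + (F - E)) (E0 + (F0 - E0)))"
      using assms(2) by simp
  qed (use assms(1) that in \<open>simp_all only: P_star_le_iff star_le_iff_pinv\<close>)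
  then show ?thesis
    unfolding DM_star_le_def P_star_le_iff dual_mat_diff mult_pinv_mult_eq_0_iff
      std_mat_dual_mat by blast
qed

end
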